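(* Let $K$ be a field and let $I\subset K[x,y]$ be a non-principal monomial ideal with $\mu(I)\leq 7$. Then $\mu(I^2)>\mu(I)$.
   Context: $\mu(L)$ denotes the minimal number of generators of a monomial ideal $L$. *)

theory Defs
  imports Complex_Main "HOL-Library.Poly_Mapping" "HOL-Library.Product_Plus"
begin

(* Exponent vectors of monomials: (a, b) stands for x^a y^b. *)
type_synonym expo = "nat \<times> nat"

(* K[x,y] as the monoid algebra of the additive monoid nat x nat:
   finitely supported coefficient functions with the convolution product. *)
type_synonym 'k bipoly = "expo \<Rightarrow>\<^sub>0 'k"

definition monomial :: "expo \<Rightarrow> 'k::field bipoly" where
  "monomial e = Poly_Mapping.single e 1"

(* A commutative ring is a module over itself via multiplication;
   its submodules are exactly its ideals. *)
interpretation ideal: module "(*) :: 'a::comm_ring_1 \<Rightarrow> 'a \<Rightarrow> 'a"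
  by standard (simp_all add: algebra_simps)

abbreviation ideal_gen :: "'a::comm_ring_1 set \<Rightarrow> 'a set" where
  "ideal_gen \<equiv> ideal.span"

definition principal_ideal :: "'a::comm_ring_1 set \<Rightarrow> bool" where
  "principal_ideal I \<longleftrightarrow> (\<exists>f. I = ideal_gen {f})"

definition ideal_mult :: "'a::comm_ring_1 set \<Rightarrow> 'a set \<Rightarrow> 'a set" where
  "ideal_mult I J = ideal_gen {f * g | f g. f \<in> I \<and> g \<in> J}"

definition monomial_ideal :: "'k::field bipoly set \<Rightarrow> bool" where
  "monomial_ideal I \<longleftrightarrow> (\<exists>E. I = ideal_gen (monomial ` E))"

(* Least size of a generating set; the generators may be arbitrary ring elements.
   A junk value arises only for ideals that are not finitely generated. *)
definition mu :: "'a::comm_ring_1 set \<Rightarrow> nat" where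
  "mu L = (LEAST n. \<exists>G. finite G \<and> card G = n \<and> ideal_gen G = L)"

end

theory Submission
  imports Defs "HOL-Library.Product_Order" "HOL-Library.Infinite_Set"
    "HOL-Library.Function_Algebras"
begin

text \<open>
  A monomial ideal is determined by the exponents minimal among those of its generators, and their
  number is \<open>\<mu>\<close> even when arbitrary polynomials are admitted as generators
  (\<open>mu_monomial_ideal\<close>): reading off the coefficients at the minimal exponents turns any generating
  set into a spanning set of a vector space whose dimension is their number. The square of the ideal
  is generated by the monomials of pairwise sums of exponents. So the claim is about a finite antichain
  \<open>A\<close> of points in the plane: \<open>A + A\<close> has more minimal elements than \<open>A\<close>, provided \<open>A\<close> has between
  2 and 7 elements.

  List \<open>A\<close> as a staircase \<open>p\<^sub>0, \<dots>, p\<^sub>n\<close> with increasing first and decreasing second coordinates, and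
  write \<open>ij\<close> for \<open>p\<^sub>i + p\<^sub>j\<close>. Near the left end the sums \<open>00\<close>, \<open>01\<close> and at least one of \<open>02\<close>, \<open>11\<close> are
  minimal; by symmetry so are \<open>nn\<close>, \<open>(n-1)n\<close> and at least one of \<open>(n-2)n\<close>, \<open>(n-1)(n-1)\<close>. Choosing one
  from each alternative gives six outer sums, which are distinct for \<open>n \<ge> 3\<close>; this settles all
  antichains with at most 5 points (for \<open>n \<le> 2\<close> some of the six are enough).

  For \<open>n \<ge> 4\<close> there are two further minimal sums, hence at least 8 (\<open>eight_minimal_sums\<close>), which
  exceeds 7. No outer sum lies below \<open>12\<close> or below \<open>(n-2)(n-1)\<close>, so the minimal sums below these are
  new. If there is only one new sum, it lies below both, and this forces it to be \<open>0n\<close>. Then \<open>0(n-1)\<close>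
  and \<open>1n\<close>, which are not above \<open>0n\<close>, must each lie above an outer sum, and the only candidates are
  \<open>11\<close> and \<open>(n-1)(n-1)\<close>. With \<open>a\<^sub>i\<close> the first coordinate of \<open>p\<^sub>i\<close>, this means
  \<open>2a\<^sub>1 \<le> a\<^sub>0 + a\<^sub>n\<^sub>-\<^sub>1\<close> and \<open>2a\<^sub>n\<^sub>-\<^sub>1 \<le> a\<^sub>1 + a\<^sub>n\<close>, while \<open>0n\<close> below \<open>12\<close> gives \<open>a\<^sub>0 + a\<^sub>n \<le> a\<^sub>1 + a\<^sub>2\<close>.
  Adding the three yields \<open>a\<^sub>n\<^sub>-\<^sub>1 \<le> a\<^sub>2\<close>, which is absurd.
\<close>

section \<open>Minimal exponents\<close>

definition minimal_exponents :: "expo set \<Rightarrow> expo set" where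
  "minimal_exponents E = {e \<in> E. \<forall>d\<in>E. d \<le> e \<longrightarrow> d = e}"

lemma minimal_exponents_mem: "e \<in> minimal_exponents E \<Longrightarrow> e \<in> E"
  by (auto simp: minimal_exponents_def)

lemma minimal_exponentsD: "e \<in> minimal_exponents E \<Longrightarrow> d \<in> E \<Longrightarrow> d \<le> e \<Longrightarrow> d = e"
  by (auto simp: minimal_exponents_def)

lemma minimal_exponent_below:
  assumes "e \<in> E"
  shows "\<exists>d \<in> minimal_exponents E. d \<le> e"
  using assms
proof (induction "fst e + snd e" arbitrary: e rule: less_induct)
  case less
  show ?case
  proof (cases "e \<in> minimal_exponents E")
    case False
    with less.prems obtain d where d: "d \<in> E" "d \<le> e" "d \<noteq> e"
      by (auto simp: minimal_exponents_def)
    then have "fst d + snd d < fst e + snd e"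
      by (auto simp: less_eq_prod_def prod_eq_iff)
    with less.hyps d show ?thesis
      using order_trans by blast
  qed auto
qed

text \<open>Both projections are injective on an antichain of the plane. Every element is bounded by a fixed
  one in one of the two coordinates, which then takes only finitely many values.\<close>

lemma finite_minimal_exponents: "finite (minimal_exponents E)"
proof (cases "minimal_exponents E = {}")
  case False
  let ?M = "minimal_exponents E"
  have inc: "d = e" if "d \<in> ?M" "e \<in> ?M" "d \<le> e" for d e
    using that by (auto simp: minimal_exponents_def)
  have inj: "inj_on fst ?M" "inj_on snd ?M"
    by (rule inj_onI, metis inc less_eq_prod_def linear order_refl)+
  obtain m where m: "m \<in> ?M"
    using False by auto
  have "?M \<subseteq> (fst -` {..fst m} \<inter> ?M) \<union> (snd -` {..snd m} \<inter> ?M)"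
  proof
    fix e
    assume e: "e \<in> ?M"
    have "fst e \<le> fst m \<or> snd e \<le> snd m"
      using inc[OF m e] by (metis less_eq_prod_def linear order_refl)
    with e show "e \<in> (fst -` {..fst m} \<inter> ?M) \<union> (snd -` {..snd m} \<inter> ?M)"
      by auto
  qed
  moreover have "finite (fst -` {..fst m} \<inter> ?M)" "finite (snd -` {..snd m} \<inter> ?M)"
    using inj by (simp_all add: finite_vimage_IntI)
  ultimately show ?thesis
    using finite_subset by blast
qed auto

text \<open>Exchanging \<open>x\<close> and \<open>y\<close> is the symmetry that lets every statement about one end of a staircase
  be transferred to the other end.\<close>

lemma minimal_exponents_swap:
  "minimal_exponents (prod.swap ` E) = prod.swap ` minimal_exponents E"
proof -
  have "prod.swap d \<le> prod.swap e \<longleftrightarrow> d \<le> e" for d e :: expo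
    by (auto simp: less_eq_prod_def)
  then have "prod.swap e \<in> minimal_exponents (prod.swap ` E) \<longleftrightarrow> e \<in> minimal_exponents E" for e
    by (simp add: minimal_exponents_def inj_image_mem_iff[OF inj_swap] inj_eq[OF inj_swap])
  from this[of "prod.swap e" for e] show ?thesis
    by (auto intro: rev_image_eqI)
qed

section \<open>Generators of monomial ideals\<close>

lemma inj_monomial: "inj (monomial :: expo \<Rightarrow> 'k::field bipoly)"
proof (rule injI)
  fix d e
  assume "monomial d = (monomial e :: 'k bipoly)"
  then have "Poly_Mapping.lookup (monomial d :: 'k bipoly) d = Poly_Mapping.lookup (monomial e) d"
    by simp
  then show "d = e"
    by (simp add: monomial_def lookup_single when_def split: if_splits)
qed

lemma monomial_add: "monomial (d + e) = (monomial d * monomial e :: 'k::field bipoly)"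
  by (simp add: monomial_def mult_single)

lemma exponent_split:
  assumes "d \<le> (e :: expo)"
  obtains c where "e = c + d"
  using assms that[of "e - d"] by (auto simp: less_eq_prod_def prod_eq_iff)

lemma keys_mem_monomial_ideal:
  fixes f :: "'k::field bipoly"
  assumes "f \<in> ideal_gen (monomial ` E)" "v \<in> Poly_Mapping.keys f"
  shows "\<exists>e\<in>E. e \<le> v"
  using assms
proof (induction arbitrary: v rule: ideal.span_induct_alt)
  case (step c x y)
  then obtain e where e: "e \<in> E" "x = monomial e"
    by auto
  have "v \<in> Poly_Mapping.keys (c * x) \<or> v \<in> Poly_Mapping.keys y"
    using subsetD[OF keys_add step.prems] by simp
  then show ?case
  proof
    assume "v \<in> Poly_Mapping.keys (c * x)"
    then obtain u where "v = u + e"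
      using keys_mult[of c x] e by (auto simp: monomial_def)
    then have "e \<le> v"
      by (simp add: less_eq_prod_def)
    with e show ?thesis by auto
  qed (use step.IH in auto)
qed auto

lemma monomial_ideal_gen_minimal:
  "ideal_gen (monomial ` minimal_exponents E :: 'k::field bipoly set) = ideal_gen (monomial ` E)"
proof (rule iffD2[OF ideal.span_eq], intro conjI subsetI)
  fix x :: "'k bipoly"
  assume "x \<in> monomial ` minimal_exponents E"
  then show "x \<in> ideal_gen (monomial ` E)"
    by (auto intro: ideal.span_base minimal_exponents_mem)
next
  fix x :: "'k bipoly"
  assume "x \<in> monomial ` E"
  then obtain e where e: "x = monomial e" "e \<in> E"
    by auto
  obtain d where d: "d \<in> minimal_exponents E" "d \<le> e"
    using minimal_exponent_below[OF e(2)] by auto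
  then obtain c where "e = c + d"
    using exponent_split by blast
  then have "x = monomial c * monomial d"
    by (simp add: e monomial_add)
  then show "x \<in> ideal_gen (monomial ` minimal_exponents E)"
    using d by (auto intro: ideal.span_scale ideal.span_base)
qed

text \<open>An exponent in the support of \<open>g\<close> lies above some element of \<open>E\<close>, so it can lie below the minimal
  exponent \<open>e\<close> only if it equals \<open>e\<close>. Of the convolution sum for the coefficient at \<open>e\<close> only the
  term with the constant coefficient of \<open>c\<close> remains. Thus multiplying by a polynomial acts on the
  coefficients at minimal exponents as a scalar.\<close>

lemma lookup_mult_at_minimal:
  fixes c g :: "'k::field bipoly"
  assumes "g \<in> ideal_gen (monomial ` E)" "e \<in> minimal_exponents E"
  shows "Poly_Mapping.lookup (c * g) e = Poly_Mapping.lookup c 0 * Poly_Mapping.lookup g e"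
proof -
  have *: "Poly_Mapping.lookup g q = 0" if "e = l + q" "l \<noteq> 0" for l q
  proof (rule ccontr)
    assume "Poly_Mapping.lookup g q \<noteq> 0"
    then obtain d where "d \<in> E" "d \<le> q"
      using keys_mem_monomial_ideal[OF assms(1), of q] by (metis in_keys_iff)
    then have "d = e"
      using minimal_exponentsD[OF assms(2)] that(1) by (auto simp: less_eq_prod_def)
    with \<open>d \<le> q\<close> that show False
      by (auto simp: less_eq_prod_def prod_eq_iff)
  qed
  have "Poly_Mapping.lookup (c * g) e
      = Sum_any (\<lambda>l. Poly_Mapping.lookup c l * Sum_any (\<lambda>q. Poly_Mapping.lookup g q when e = l + q))"
    by (rule lookup_mult)
  also have "\<dots> = Sum_any (\<lambda>l. Poly_Mapping.lookup c l * Poly_Mapping.lookup g e when l = 0)"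
  proof (rule Sum_any.cong)
    fix l
    show "Poly_Mapping.lookup c l * Sum_any (\<lambda>q. Poly_Mapping.lookup g q when e = l + q)
        = (Poly_Mapping.lookup c l * Poly_Mapping.lookup g e when l = 0)"
    proof (cases "l = 0")
      case False
      then have "(Poly_Mapping.lookup g q when e = l + q) = 0" for q
        using * by (simp add: when_def)
      with False show ?thesis by simp
    qed simp
  qed
  finally show ?thesis by simp
qed

interpretation coefficients: vector_space "\<lambda>(c::'k::field) (f :: expo \<Rightarrow> 'k) x. c * f x"
  by standard (simp_all add: fun_eq_iff distrib_left distrib_right)

text \<open>The map \<open>v\<close> that restricts coefficient functions to the minimal exponents is semilinear by
  \<open>lookup_mult_at_minimal\<close>, so the images of any ideal generators span, over the field, the image
  of the whole ideal. This image contains the unit vectors \<open>\<delta> d\<close> at the minimal exponents.\<close>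

lemma card_minimal_exponents_le_generators:
  fixes G :: "'k::field bipoly set"
  assumes "finite G" and G: "ideal_gen G = ideal_gen (monomial ` E)"
  shows "card (minimal_exponents E) \<le> card G"
proof -
  let ?M = "minimal_exponents E"
  define v :: "'k bipoly \<Rightarrow> expo \<Rightarrow> 'k"
    where "v f = (\<lambda>e. if e \<in> ?M then Poly_Mapping.lookup f e else 0)" for f
  have span: "v f \<in> coefficients.span (v ` G)" if "f \<in> ideal_gen G" for f
    using that
  proof (induction rule: ideal.span_induct_alt)
    case base
    have "v 0 = 0"
      by (auto simp: v_def)
    then show ?case
      using coefficients.span_zero by metis
  next
    case (step c x y)
    have "x \<in> ideal_gen (monomial ` E)"
      using step.hyps G ideal.span_base by blast
    then have "v (c * x + y) = (\<lambda>e. Poly_Mapping.lookup c 0 * v x e) + v y"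
      by (auto simp: v_def lookup_add lookup_mult_at_minimal)
    moreover have "(\<lambda>e. Poly_Mapping.lookup c 0 * v x e) \<in> coefficients.span (v ` G)"
      using step.hyps by (intro coefficients.span_scale coefficients.span_base) auto
    ultimately show ?case
      using step.IH coefficients.span_add by metis
  qed
  define \<delta> :: "expo \<Rightarrow> expo \<Rightarrow> 'k" where "\<delta> d = (\<lambda>e. if e = d then 1 else 0)" for d
  have inj: "inj_on \<delta> ?M"
    by (auto simp: inj_on_def \<delta>_def fun_eq_iff split: if_splits)
  have "\<delta> ` ?M \<subseteq> coefficients.span (v ` G)"
  proof (intro image_subsetI)
    fix d
    assume d: "d \<in> ?M"
    then have "monomial d \<in> ideal_gen G"
      unfolding G by (auto intro: ideal.span_base minimal_exponents_mem)
    moreover have "v (monomial d) = \<delta> d"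
      using d by (auto simp: v_def \<delta>_def monomial_def lookup_single when_def)
    ultimately show "\<delta> d \<in> coefficients.span (v ` G)"
      using span by metis
  qed
  moreover have "coefficients.independent (\<delta> ` ?M)"
    unfolding coefficients.dependent_def
  proof safe
    fix d
    assume "\<delta> d \<in> coefficients.span (\<delta> ` ?M - {\<delta> d})"
    moreover have "coefficients.span (\<delta> ` ?M - {\<delta> d}) \<subseteq> {f. f d = 0}"
      by (rule coefficients.span_minimal) (auto simp: coefficients.subspace_def \<delta>_def)
    ultimately show False
      by (auto simp: \<delta>_def)
  qed
  ultimately have "card (\<delta> ` ?M) \<le> card (v ` G)"
    using coefficients.independent_span_bound[of "v ` G"] assms(1) by auto
  then show ?thesis
    using card_image[OF inj] card_image_le[OF assms(1), of v] by simp
qed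

theorem mu_monomial_ideal:
  "mu (ideal_gen (monomial ` E :: 'k::field bipoly set)) = card (minimal_exponents E)"
  unfolding mu_def
proof (rule Least_equality)
  have "card (monomial ` minimal_exponents E :: 'k bipoly set) = card (minimal_exponents E)"
    by (meson card_image inj_monomial inj_on_subset subset_UNIV)
  then show "\<exists>G :: 'k bipoly set. finite G \<and> card G = card (minimal_exponents E)
      \<and> ideal_gen G = ideal_gen (monomial ` E)"
    using finite_minimal_exponents monomial_ideal_gen_minimal by blast
next
  fix m
  assume "\<exists>G :: 'k bipoly set. finite G \<and> card G = m \<and> ideal_gen G = ideal_gen (monomial ` E)"
  then show "card (minimal_exponents E) \<le> m"
    using card_minimal_exponents_le_generators by metis
qed

lemma ideal_mult_ideal_gen:
  fixes S T :: "'a::comm_ring_1 set"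
  shows "ideal_mult (ideal_gen S) (ideal_gen T) = ideal_gen {s * t | s t. s \<in> S \<and> t \<in> T}"
    (is "_ = ?W")
  unfolding ideal_mult_def
proof (rule antisym)
  have 1: "s * g \<in> ?W" if "s \<in> S" "g \<in> ideal_gen T" for s g
  proof -
    have "ideal_gen T \<subseteq> {g. s * g \<in> ?W}"
    proof (rule ideal.span_minimal)
      have "s * (c * x) \<in> ?W" if "s * x \<in> ?W" for c x
        using ideal.span_scale[OF that, of c] by (simp only: mult.left_commute[of s c x])
      then show "ideal.subspace {g. s * g \<in> ?W}"
        by (auto simp: ideal.subspace_def distrib_left intro: ideal.span_zero ideal.span_add)
    qed (use that(1) in \<open>auto intro: ideal.span_base\<close>)
    with that show ?thesis by auto
  qed
  have 2: "f * g \<in> ?W" if "f \<in> ideal_gen S" "g \<in> ideal_gen T" for f g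
  proof -
    have "ideal_gen S \<subseteq> {f. f * g \<in> ?W}"
      by (rule ideal.span_minimal)
        (use 1 that(2) in \<open>auto simp: ideal.subspace_def distrib_right mult.assoc
           simp del: ideal.scale_scale intro: ideal.span_zero ideal.span_add ideal.span_scale\<close>)
    with that show ?thesis by auto
  qed
  then show "ideal_gen {f * g | f g. f \<in> ideal_gen S \<and> g \<in> ideal_gen T} \<subseteq> ?W"
    by (intro ideal.span_minimal) auto
  show "?W \<subseteq> ideal_gen {f * g | f g. f \<in> ideal_gen S \<and> g \<in> ideal_gen T}"
    by (intro ideal.span_mono) (auto intro: ideal.span_base)
qed

lemma ideal_mult_monomial:
  "ideal_mult (ideal_gen (monomial ` D)) (ideal_gen (monomial ` E :: 'k::field bipoly set))
     = ideal_gen (monomial ` {d + e | d e. d \<in> D \<and> e \<in> E})"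
proof -
  have "{s * t | s t. s \<in> monomial ` D \<and> t \<in> (monomial ` E :: 'k bipoly set)}
      = monomial ` {d + e | d e. d \<in> D \<and> e \<in> E}"
  proof (intro equalityI subsetI)
    fix x :: "'k bipoly"
    assume "x \<in> {s * t | s t. s \<in> monomial ` D \<and> t \<in> monomial ` E}"
    then obtain d e where "d \<in> D" "e \<in> E" "x = monomial d * monomial e"
      by blast
    then show "x \<in> monomial ` {d + e | d e. d \<in> D \<and> e \<in> E}"
      unfolding monomial_add[symmetric] by blast
  next
    fix x :: "'k bipoly"
    assume "x \<in> monomial ` {d + e | d e. d \<in> D \<and> e \<in> E}"
    then obtain d e where "d \<in> D" "e \<in> E" "x = monomial (d + e)"
      by blast
    then show "x \<in> {s * t | s t. s \<in> monomial ` D \<and> t \<in> monomial ` E}"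
      unfolding monomial_add by blast
  qed
  then show ?thesis
    by (simp add: ideal_mult_ideal_gen)
qed

lemma card_minimal_exponents_ge_2:
  assumes "\<not> principal_ideal (ideal_gen (monomial ` E :: 'k::field bipoly set))"
  shows "2 \<le> card (minimal_exponents E)"
proof (rule ccontr)
  assume "\<not> ?thesis"
  then have "card (minimal_exponents E) = 0 \<or> card (minimal_exponents E) = 1"
    by auto
  then consider "minimal_exponents E = {}" | e where "minimal_exponents E = {e}"
    by (auto simp: finite_minimal_exponents card_1_singleton_iff)
  then have "\<exists>f. ideal_gen (monomial ` minimal_exponents E :: 'k bipoly set) = ideal_gen {f}"
  proof cases
    case 1
    have "ideal_gen {} = ideal_gen {0 :: 'k bipoly}"
      by (rule iffD2[OF ideal.span_eq]) (auto intro: ideal.span_zero)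
    with 1 show ?thesis by auto
  qed auto
  with assms show False
    unfolding principal_ideal_def monomial_ideal_gen_minimal by blast
qed

section \<open>Sums of two points of a staircase\<close>

definition pair_sum :: "(nat \<Rightarrow> nat) \<Rightarrow> (nat \<Rightarrow> nat) \<Rightarrow> nat \<Rightarrow> nat \<Rightarrow> expo" where
  "pair_sum a b i j = (a i + a j, b i + b j)"

text \<open>The \<open>n + 1\<close> points \<open>(a i, b i)\<close> with \<open>i \<le> n\<close> form an antichain listed from left to right;
  the values of \<open>a\<close> and \<open>b\<close> beyond \<open>n\<close> are arbitrary.\<close>

locale staircase =
  fixes n :: nat and a b :: "nat \<Rightarrow> nat"
  assumes a_less: "i < j \<Longrightarrow> j \<le> n \<Longrightarrow> a i < a j"
    and b_less: "i < j \<Longrightarrow> j \<le> n \<Longrightarrow> b j < b i"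
begin

abbreviation p :: "nat \<Rightarrow> nat \<Rightarrow> expo" where
  "p \<equiv> pair_sum a b"

definition pair_sums :: "expo set" where
  "pair_sums = {p i j | i j. i \<le> j \<and> j \<le> n}"

lemma a_le: "i \<le> j \<Longrightarrow> j \<le> n \<Longrightarrow> a i \<le> a j"
  using a_less[of i j] by (cases "i = j") auto

lemma b_le: "i \<le> j \<Longrightarrow> j \<le> n \<Longrightarrow> b j \<le> b i"
  using b_less[of i j] by (cases "i = j") auto

text \<open>Exchanging the coordinates and reversing the order of the points turns the point \<open>i\<close> into the
  point \<open>n - i\<close>, so statements about the left end yield those about the right end.\<close>

lemma mirror: "staircase n (\<lambda>i. b (n - i)) (\<lambda>i. a (n - i))"
  by standard (auto intro: a_less b_less)

lemma mirror_le:
  assumes "p i j \<le> p k l" "i \<le> n" "j \<le> n" "k \<le> n" "l \<le> n"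
  shows "pair_sum (\<lambda>i. b (n - i)) (\<lambda>i. a (n - i)) (n - j) (n - i)
     \<le> pair_sum (\<lambda>i. b (n - i)) (\<lambda>i. a (n - i)) (n - l) (n - k)"
  using assms by (auto simp: pair_sum_def)

text \<open>The sums near the left end have small first coordinates, which leaves few sums below them.
  They have large second coordinates, which the sums above them reach only by involving a point
  near the left end.\<close>

lemma below_00:
  assumes "p i j \<le> p 0 0" "i \<le> j" "j \<le> n"
  shows "i = 0 \<and> j = 0"
  using assms a_less[of 0 j] a_le[of 0 i] by (cases "j = 0") (auto simp: pair_sum_def)

lemma below_01:
  assumes "p i j \<le> p 0 1" "i \<le> j" "j \<le> n" "1 \<le> n"
  shows "i = 0 \<and> j = 1"
proof -
  have "i = 0"
    using assms a_less[of 0 i] a_le[of 1 j] by (cases "i = 0") (auto simp: pair_sum_def)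
  moreover from this have "j \<le> 1"
    using assms a_less[of 1 j] by (cases "j \<le> 1") (auto simp: pair_sum_def)
  moreover have "j \<noteq> 0"
    using assms b_less[of 0 1] \<open>i = 0\<close> by (cases "j = 0") (auto simp: pair_sum_def)
  ultimately show ?thesis by auto
qed

lemma below_02:
  assumes "p i j \<le> p 0 2" "i \<le> j" "j \<le> n" "2 \<le> n"
  shows "i = 0 \<and> j = 2 \<or> i = 1 \<and> j = 1"
proof (cases "i = 0")
  case True
  then have "j \<le> 2"
    using assms a_less[of 2 j] by (cases "j \<le> 2") (auto simp: pair_sum_def)
  moreover have "\<not> j < 2"
    using assms b_less[of j 2] True by (auto simp: pair_sum_def)
  ultimately show ?thesis
    using True by auto
next
  case False
  then have "j < 2"
    using assms a_less[of 0 i] a_le[of 2 j] by (cases "j < 2") (auto simp: pair_sum_def)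
  with False assms show ?thesis by auto
qed

lemma above_00:
  assumes "p 0 0 \<le> p i j" "i \<le> j" "j \<le> n"
  shows "i = 0 \<and> j = 0"
  using assms b_less[of 0 j] b_le[of 0 i] by (cases "j = 0") (auto simp: pair_sum_def)

lemma above_01:
  assumes "p 0 1 \<le> p i j" "i \<le> j" "j \<le> n" "1 \<le> n"
  shows "i = 0 \<and> j = 1"
proof -
  have "i = 0"
    using assms b_less[of 0 i] b_le[of 1 j] by (cases "i = 0") (auto simp: pair_sum_def)
  moreover from this have "j \<le> 1"
    using assms b_less[of 1 j] by (cases "j \<le> 1") (auto simp: pair_sum_def)
  moreover have "j \<noteq> 0"
    using assms a_less[of 0 1] \<open>i = 0\<close> by (cases "j = 0") (auto simp: pair_sum_def)
  ultimately show ?thesis by auto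
qed

lemma above_02:
  assumes "p 0 2 \<le> p i j" "i \<le> j" "j \<le> n" "2 \<le> n"
  shows "i = 0 \<and> j = 2 \<or> i = 1 \<and> j = 1"
proof (cases "i = 0")
  case True
  then have "j \<le> 2"
    using assms b_less[of 2 j] by (cases "j \<le> 2") (auto simp: pair_sum_def)
  moreover have "\<not> j < 2"
    using assms a_less[of j 2] True by (auto simp: pair_sum_def)
  ultimately show ?thesis
    using True by auto
next
  case False
  then have "j < 2"
    using assms b_less[of 0 i] b_le[of 2 j] by (cases "j < 2") (auto simp: pair_sum_def)
  with False assms show ?thesis by auto
qed

lemma above_11:
  assumes "p 1 1 \<le> p i j" "i \<le> j" "j \<le> n" "1 \<le> n"
  shows "i = 0 \<or> i = 1 \<and> j = 1"
proof (cases "i = 0")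
  case False
  then have "\<not> 1 < j"
    using assms b_less[of 1 j] b_le[of 1 i] by (auto simp: pair_sum_def)
  with False assms show ?thesis by auto
qed auto

lemma in_pair_sums: "i \<le> j \<Longrightarrow> j \<le> n \<Longrightarrow> p i j \<in> pair_sums"
  by (auto simp: pair_sums_def)

lemma minimal_sum_below:
  assumes "i \<le> j" "j \<le> n"
  obtains k l where "p k l \<in> minimal_exponents pair_sums" "p k l \<le> p i j" "k \<le> l" "l \<le> n"
proof -
  obtain d where d: "d \<in> minimal_exponents pair_sums" "d \<le> p i j"
    using minimal_exponent_below in_pair_sums[OF assms] by blast
  moreover obtain k l where "d = p k l" "k \<le> l" "l \<le> n"
    using minimal_exponents_mem[OF d(1)] by (auto simp: pair_sums_def)
  ultimately show ?thesis
    using that by blast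
qed

lemma minimal_00: "p 0 0 \<in> minimal_exponents pair_sums"
  using minimal_sum_below[of 0 0] below_00 by (metis le0 order_refl)

lemma minimal_01: "1 \<le> n \<Longrightarrow> p 0 1 \<in> minimal_exponents pair_sums"
  using minimal_sum_below[of 0 1] below_01 by (metis le0)

lemma minimal_02_or_11:
  assumes "2 \<le> n"
  shows "p 0 2 \<in> minimal_exponents pair_sums \<or> p 1 1 \<in> minimal_exponents pair_sums"
  using minimal_sum_below[of 0 2] below_02 assms by (metis le0)

interpretation mirror: staircase n "\<lambda>i. b (n - i)" "\<lambda>i. a (n - i)"
  by (rule mirror)

lemma mirror_pair_sum:
  "i \<le> n \<Longrightarrow> j \<le> n \<Longrightarrow> mirror.p (n - j) (n - i) = prod.swap (p i j)"
  by (simp add: pair_sum_def)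

lemma mirror_pair_sums: "mirror.pair_sums = prod.swap ` pair_sums"
proof (intro equalityI subsetI)
  fix e
  assume "e \<in> mirror.pair_sums"
  then obtain i j where "e = mirror.p i j" "i \<le> j" "j \<le> n"
    by (auto simp: mirror.pair_sums_def)
  then have "e = prod.swap (p (n - j) (n - i))" "n - j \<le> n - i" "n - i \<le> n"
    using mirror_pair_sum[of "n - j" "n - i"] by auto
  then show "e \<in> prod.swap ` pair_sums"
    using in_pair_sums by blast
next
  fix e
  assume "e \<in> prod.swap ` pair_sums"
  then obtain i j where "e = prod.swap (p i j)" "i \<le> j" "j \<le> n"
    by (auto simp: pair_sums_def)
  then have "e = mirror.p (n - j) (n - i)" "n - j \<le> n - i" "n - i \<le> n"
    using mirror_pair_sum[of i j] by auto
  then show "e \<in> mirror.pair_sums"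
    using mirror.in_pair_sums by metis
qed

lemma minimal_mirror:
  assumes "mirror.p (n - j) (n - i) \<in> minimal_exponents mirror.pair_sums" "i \<le> n" "j \<le> n"
  shows "p i j \<in> minimal_exponents pair_sums"
  using assms by (simp add: mirror_pair_sums mirror_pair_sum minimal_exponents_swap inj_image_mem_iff)

lemma minimal_nn: "p n n \<in> minimal_exponents pair_sums"
  by (rule minimal_mirror) (use mirror.minimal_00 in auto)

lemma minimal_penultimate: "1 \<le> n \<Longrightarrow> p (n - 1) n \<in> minimal_exponents pair_sums"
  by (rule minimal_mirror) (use mirror.minimal_01 in auto)

lemma minimal_third_last:
  assumes "2 \<le> n"
  shows "p (n - 2) n \<in> minimal_exponents pair_sums \<or> p (n - 1) (n - 1) \<in> minimal_exponents pair_sums"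
  using mirror.minimal_02_or_11[OF assms] minimal_mirror[of n "n - 2"]
    minimal_mirror[of "n - 1" "n - 1"] assms by auto

lemma above_nn:
  assumes "p n n \<le> p i j" "i \<le> j" "j \<le> n"
  shows "i = n \<and> j = n"
proof -
  have "n - j = 0 \<and> n - i = 0"
    by (rule mirror.above_00) (use mirror_le[OF assms(1)] assms(2-) in auto)
  then show ?thesis
    using assms(2-) by arith
qed

lemma above_penultimate:
  assumes "p (n - 1) n \<le> p i j" "i \<le> j" "j \<le> n" "1 \<le> n"
  shows "i = n - 1 \<and> j = n"
proof -
  have "n - j = 0 \<and> n - i = 1"
    by (rule mirror.above_01) (use mirror_le[OF assms(1)] assms(2-) in auto)
  then show ?thesis
    using assms(2-) by arith
qed

lemma above_third_last:
  assumes "p (n - 2) n \<le> p i j" "i \<le> j" "j \<le> n" "2 \<le> n"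
  shows "i = n - 2 \<and> j = n \<or> i = n - 1 \<and> j = n - 1"
proof -
  have "n - j = 0 \<and> n - i = 2 \<or> n - j = 1 \<and> n - i = 1"
    by (rule mirror.above_02) (use mirror_le[OF assms(1)] assms(2-) in auto)
  then show ?thesis
    using assms(2-) by arith
qed

lemma above_penultimate_double:
  assumes "p (n - 1) (n - 1) \<le> p i j" "i \<le> j" "j \<le> n" "1 \<le> n"
  shows "j = n \<or> i = n - 1 \<and> j = n - 1"
proof -
  have "n - j = 0 \<or> n - j = 1 \<and> n - i = 1"
    by (rule mirror.above_11) (use mirror_le[OF assms(1)] assms(2-) in auto)
  then show ?thesis
    using assms(2-) by arith
qed

lemma length_le_card_minimal:
  assumes "distinct xs" "set xs \<subseteq> minimal_exponents pair_sums"
  shows "length xs \<le> card (minimal_exponents pair_sums)"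
  using distinct_card[OF assms(1)] card_mono[OF finite_minimal_exponents assms(2)] by simp

text \<open>Sums are told apart by their first coordinates.\<close>

lemma strictly_ordered_distinct:
  "sorted_wrt (<) (map fst (xs :: expo list)) \<Longrightarrow> distinct xs"
  by (simp add: strict_sorted_iff distinct_map)

lemma three_minimal_sums:
  assumes "1 \<le> n"
  shows "3 \<le> card (minimal_exponents pair_sums)"
proof -
  have "distinct [p 0 0, p 0 1, p n n]"
    using a_less[of 0 1] a_le[of 1 n] assms
    by (intro strictly_ordered_distinct) (auto simp: pair_sum_def)
  from length_le_card_minimal[OF this] show ?thesis
    using minimal_00 minimal_01 minimal_nn assms by simp
qed

lemma four_minimal_sums:
  assumes "2 \<le> n"
  shows "4 \<le> card (minimal_exponents pair_sums)"
proof -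
  have "a 0 < a 1" "a 1 \<le> a (n - 1)" "a (n - 1) < a n"
    using assms by (auto intro: a_less a_le)
  then have "distinct [p 0 0, p 0 1, p (n - 1) n, p n n]"
    by (intro strictly_ordered_distinct) (auto simp: pair_sum_def)
  from length_le_card_minimal[OF this] show ?thesis
    using minimal_00 minimal_01 minimal_penultimate minimal_nn assms by simp
qed

text \<open>With at least four points the two ends no longer interfere: the first coordinates of the three
  sums at the left end are below those of the three sums at the right end, whichever alternative
  for \<open>s\<close> and \<open>r\<close> holds.\<close>

lemma outer_minimal_sums:
  assumes "3 \<le> n"
  obtains s r where "s = p 0 2 \<or> s = p 1 1" "r = p (n - 2) n \<or> r = p (n - 1) (n - 1)"
    "distinct [p 0 0, p 0 1, s, r, p (n - 1) n, p n n]"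
    "set [p 0 0, p 0 1, s, r, p (n - 1) n, p n n] \<subseteq> minimal_exponents pair_sums"
proof -
  obtain s where s: "s = p 0 2 \<or> s = p 1 1" "s \<in> minimal_exponents pair_sums"
    using minimal_02_or_11 assms by fastforce
  obtain r where r: "r = p (n - 2) n \<or> r = p (n - 1) (n - 1)" "r \<in> minimal_exponents pair_sums"
    using minimal_third_last assms by fastforce
  have "a 0 < a 1" "a 1 < a 2" "a 1 \<le> a (n - 2)" "a 2 \<le> a (n - 1)" "a (n - 2) < a (n - 1)"
    "a (n - 1) < a n"
    using assms by (auto intro: a_less a_le)
  then have "distinct [p 0 0, p 0 1, s, r, p (n - 1) n, p n n]"
    using s(1) r(1) by (intro strictly_ordered_distinct) (auto simp: pair_sum_def)
  moreover have "set [p 0 0, p 0 1, s, r, p (n - 1) n, p n n] \<subseteq> minimal_exponents pair_sums"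
    using s(2) r(2) minimal_00 minimal_01 minimal_penultimate minimal_nn assms by simp
  ultimately show ?thesis
    using that s(1) r(1) by blast
qed

lemma six_minimal_sums:
  assumes "3 \<le> n"
  shows "6 \<le> card (minimal_exponents pair_sums)"
proof -
  obtain s r where "s = p 0 2 \<or> s = p 1 1" "r = p (n - 2) n \<or> r = p (n - 1) (n - 1)"
    and T: "distinct [p 0 0, p 0 1, s, r, p (n - 1) n, p n n]"
      "set [p 0 0, p 0 1, s, r, p (n - 1) n, p n n] \<subseteq> minimal_exponents pair_sums"
    by (rule outer_minimal_sums[OF assms])
  from length_le_card_minimal[OF T] show ?thesis by simp
qed

text \<open>The first coordinates force one of the two points to be among the first two, the second
  coordinates force one to be among the last two. Of the four combinations all but the extreme one
  overshoot in one of the coordinates.\<close>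

lemma below_inner_pairs:
  assumes "p k l \<le> p 1 2" "p k l \<le> p (n - 2) (n - 1)" "k \<le> l" "l \<le> n" "4 \<le> n"
  shows "k = 0 \<and> l = n"
proof -
  have a: "a k + a l \<le> a 1 + a 2" and b: "b k + b l \<le> b (n - 2) + b (n - 1)"
    using assms by (auto simp: pair_sum_def)
  have "k \<le> 1"
  proof (rule ccontr)
    assume "\<not> k \<le> 1"
    then show False
      using a a_le[of 2 k] a_le[of 2 l] a_less[of 1 2] assms(3-) by auto
  qed
  have "n - 1 \<le> l"
  proof (rule ccontr)
    assume "\<not> n - 1 \<le> l"
    then have "b (n - 2) \<le> b k" "b (n - 2) \<le> b l" "b (n - 1) < b (n - 2)"
      using assms(3-) by (auto intro: b_le b_less)
    with b show False by linarith
  qed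
  have "k \<noteq> 1"
    using a a_less[of 2 l] \<open>n - 1 \<le> l\<close> assms(4,5) by fastforce
  moreover have "l \<noteq> n - 1"
    using b b_less[of k "n - 2"] \<open>k \<le> 1\<close> assms(5) by fastforce
  ultimately show ?thesis
    using \<open>k \<le> 1\<close> \<open>n - 1 \<le> l\<close> assms(4) by linarith
qed

text \<open>Otherwise at most one minimal sum \<open>q\<close> lies outside the set \<open>T\<close> of six outer sums. Only
  sums that involve an extreme point, apart from 11 and (n-1)(n-1), lie above an element of \<open>T\<close>
  (the fact \<open>cover\<close>), so testing suitable sums against \<open>T\<close> and \<open>q\<close> first
  determines \<open>q\<close> and then gives contradictory inequalities.\<close>

lemma eight_minimal_sums:
  assumes n: "4 \<le> n"
  shows "8 \<le> card (minimal_exponents pair_sums)"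
proof (rule ccontr)
  assume few: "\<not> ?thesis"
  let ?M = "minimal_exponents pair_sums"
  obtain s r where s: "s = p 0 2 \<or> s = p 1 1" and r: "r = p (n - 2) n \<or> r = p (n - 1) (n - 1)"
    and T: "distinct [p 0 0, p 0 1, s, r, p (n - 1) n, p n n]" (is "distinct ?T")
      "set [p 0 0, p 0 1, s, r, p (n - 1) n, p n n] \<subseteq> ?M"
    by (rule outer_minimal_sums) (use n in simp)
  define T where "T = set ?T"
  have one_more: "q = q'" if "q \<in> ?M" "q' \<in> ?M" "q \<notin> T" "q' \<notin> T" for q q'
  proof (rule ccontr)
    assume "q \<noteq> q'"
    then have "distinct (q # q' # ?T)"
      using T(1) that by (simp add: T_def)
    from length_le_card_minimal[OF this] show False
      using T(2) that few by simp
  qed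
  have cover: "i = 0 \<and> (j \<le> 2 \<or> t = p 1 1) \<or> i = 1 \<and> j = 1
      \<or> j = n \<and> (n - 2 \<le> i \<or> t = p (n - 1) (n - 1)) \<or> i = n - 1 \<and> j = n - 1"
    if t: "t \<in> T" "t \<le> p i j" "i \<le> j" "j \<le> n" for t i j
  proof -
    consider "t = p 0 0" | "t = p 0 1" | "t = p 0 2" | "t = p 1 1" | "t = p (n - 2) n"
      | "t = p (n - 1) (n - 1)" | "t = p (n - 1) n" | "t = p n n"
      using t(1) s r by (auto simp: T_def)
    then show ?thesis
    proof cases
      case 1 then show ?thesis using above_00[of i j] that by auto
    next
      case 2 then show ?thesis using above_01[of i j] that n by auto
    next
      case 3 then show ?thesis using above_02[of i j] that n by auto
    next
      case 4 then show ?thesis using above_11[of i j] that n by auto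
    next
      case 5 then show ?thesis using above_third_last[of i j] that n by auto
    next
      case 6 then show ?thesis using above_penultimate_double[of i j] that n by auto
    next
      case 7 then show ?thesis using above_penultimate[of i j] that n by auto
    next
      case 8 then show ?thesis using above_nn[of i j] that n by auto
    qed
  qed
  have below: "\<exists>d\<in>?M. d \<le> p i j" if "i \<le> j" "j \<le> n" for i j
    using minimal_exponent_below in_pair_sums[OF that] by blast
  \<comment> \<open>The sums 12 and (n-2)(n-1) are inner ones, which no element of \<open>T\<close> lies below.\<close>
  obtain q where q: "q \<in> ?M" "q \<le> p 1 2"
    using below[of 1 2] n by auto
  have le: "n - 2 \<le> n - 1"
    by linarith
  obtain q' where q': "q' \<in> ?M" "q' \<le> p (n - 2) (n - 1)"
    using below[OF le] by auto
  have notT: "q \<notin> T" "q' \<notin> T"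
    using cover[of q 1 2] cover[of q' "n - 2" "n - 1"] q(2) q'(2) n le by auto
  then have "q = q'"
    using one_more q(1) q'(1) by blast
  have "q = p 0 n"
  proof -
    obtain k l where "q = p k l" "k \<le> l" "l \<le> n"
      using minimal_exponents_mem[OF q(1)] by (auto simp: pair_sums_def)
    then show ?thesis
      using below_inner_pairs[of k l] q(2) q'(2) \<open>q = q'\<close> n by auto
  qed
  \<comment> \<open>Next the sums 0(n-1) and 1n, each next to 0n but not above it.\<close>
  obtain x where x: "x \<in> ?M" "x \<le> p 0 (n - 1)"
    using below[of 0 "n - 1"] n by auto
  have "x \<noteq> q"
    using x(2) a_less[of "n - 1" n] n \<open>q = p 0 n\<close> by (auto simp: pair_sum_def)
  then have "x \<in> T"
    using one_more[OF x(1) q(1)] notT by blast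
  then have "x = p 1 1"
    using cover[of x 0 "n - 1"] x(2) n by auto
  obtain y where y: "y \<in> ?M" "y \<le> p 1 n"
    using below[of 1 n] n by auto
  have "y \<noteq> q"
    using y(2) b_less[of 0 1] n \<open>q = p 0 n\<close> by (auto simp: pair_sum_def)
  then have "y \<in> T"
    using one_more[OF y(1) q(1)] notT by blast
  then have "y = p (n - 1) (n - 1)"
    using cover[of y 1 n] y(2) n by auto
  have "2 * a 1 \<le> a 0 + a (n - 1)" "2 * a (n - 1) \<le> a 1 + a n" "a 0 + a n \<le> a 1 + a 2"
    using x(2) y(2) q(2) \<open>x = p 1 1\<close> \<open>y = p (n - 1) (n - 1)\<close> \<open>q = p 0 n\<close>
    by (auto simp: pair_sum_def)
  then have "a (n - 1) \<le> a 2"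
    by linarith
  then show False
    using a_less[of 2 "n - 1"] n by fastforce
qed

text \<open>The bounds 3, 4, 6 and 8 for 2, 3, 4 and at least 5 points stay above the number of points up to
  7 points.\<close>

theorem card_minimal_sums:
  assumes "1 \<le> n" "n \<le> 6"
  shows "n + 1 < card (minimal_exponents pair_sums)"
proof -
  consider "n = 1" | "n = 2" | "n = 3" | "4 \<le> n"
    using assms by linarith
  then show ?thesis
    by cases (use assms three_minimal_sums four_minimal_sums six_minimal_sums eight_minimal_sums in auto)
qed

end

section \<open>Antichains as staircases\<close>

text \<open>The first coordinates, enumerated increasingly, determine the second ones, and these decrease
  because two points in increasing position would be comparable.\<close>

lemma antichain_staircase:
  assumes "finite A" "A \<noteq> {}" and antichain: "\<And>d e. d \<in> A \<Longrightarrow> e \<in> A \<Longrightarrow> d \<le> e \<Longrightarrow> d = e"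
  obtains a b where "staircase (card A - 1) a b" "A = (\<lambda>i. (a i, b i)) ` {..card A - 1}"
proof -
  have inj: "inj_on fst A"
    by (rule inj_onI, metis antichain less_eq_prod_def linear order_refl)
  define a where "a = enumerate (fst ` A)"
  have card: "card (fst ` A) = card A"
    by (rule card_image[OF inj])
  have pos: "0 < card A"
    using assms(1,2) by (simp add: card_gt_0_iff)
  have bij: "bij_betw a {..<card A} (fst ` A)"
    using finite_bij_enumerate[of "fst ` A"] assms(1) card by (simp add: a_def)
  have "\<forall>i<card A. \<exists>y. (a i, y) \<in> A"
    using bij by (force simp: bij_betw_def)
  then obtain b where b: "(a i, b i) \<in> A" if "i < card A" for i
    by metis
  have "staircase (card A - 1) a b"
  proof
    fix i j
    assume ij: "i < j" "j \<le> card A - 1"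
    then show *: "a i < a j"
      using finite_enumerate_mono[of i j "fst ` A"] assms(1) card pos by (simp add: a_def)
    show "b j < b i"
    proof (rule ccontr)
      assume "\<not> b j < b i"
      then have "(a i, b i) = (a j, b j)"
        using * ij pos by (intro antichain b) auto
      with * show False by simp
    qed
  qed
  moreover have "A = (\<lambda>i. (a i, b i)) ` {..card A - 1}"
  proof (intro equalityI subsetI)
    fix e
    assume e: "e \<in> A"
    then obtain i where i: "i < card A" "fst e = a i"
      using bij by (force simp: bij_betw_def)
    then have "e = (a i, b i)"
      using inj_onD[OF inj, of e "(a i, b i)"] e b by simp
    with i show "e \<in> (\<lambda>i. (a i, b i)) ` {..card A - 1}"
      by auto
  next
    fix e
    assume "e \<in> (\<lambda>i. (a i, b i)) ` {..card A - 1}"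
    then show "e \<in> A"
      using b pos by auto
  qed
  ultimately show ?thesis
    using that by blast
qed

lemma (in staircase) sumset_eq_pair_sums:
  assumes "A = (\<lambda>i. (a i, b i)) ` {..n}"
  shows "{d + e | d e. d \<in> A \<and> e \<in> A} = pair_sums"
proof (intro equalityI subsetI)
  fix x
  assume "x \<in> {d + e | d e. d \<in> A \<and> e \<in> A}"
  then obtain i j where ij: "i \<le> n" "j \<le> n" "x = p i j"
    by (auto simp: assms pair_sum_def)
  then show "x \<in> pair_sums"
    using in_pair_sums[of i j] in_pair_sums[of j i] by (cases "i \<le> j") (auto simp: pair_sum_def add.commute)
next
  fix x
  assume "x \<in> pair_sums"
  then obtain i j where "i \<le> j" "j \<le> n" "x = p i j"
    by (auto simp: pair_sums_def)
  then have "i \<le> n" "j \<le> n" "x = (a i, b i) + (a j, b j)"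
    by (auto simp: pair_sum_def)
  then show "x \<in> {d + e | d e. d \<in> A \<and> e \<in> A}"
    unfolding assms by blast
qed

section \<open>The number of generators of the square\<close>

theorem proposition4p9:
  fixes I :: "'k::field bipoly set"
  assumes "monomial_ideal I"
    and "\<not> principal_ideal I"
    and "mu I \<le> 7"
  shows "mu (ideal_mult I I) > mu I"
proof -
  obtain E where E: "I = ideal_gen (monomial ` E)"
    using assms(1) by (auto simp: monomial_ideal_def)
  define A where "A = minimal_exponents E"
  have I: "I = ideal_gen (monomial ` A)"
    by (simp add: A_def monomial_ideal_gen_minimal E)
  have mu_I: "mu I = card A"
    by (simp add: A_def mu_monomial_ideal E)
  have card: "2 \<le> card A" "card A \<le> 7"
    using card_minimal_exponents_ge_2[of E] assms(2,3) mu_I by (auto simp: A_def E)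
  have "finite A" "A \<noteq> {}" "\<And>d e. d \<in> A \<Longrightarrow> e \<in> A \<Longrightarrow> d \<le> e \<Longrightarrow> d = e"
    unfolding A_def
    by (rule finite_minimal_exponents, use card in \<open>force simp: A_def\<close>)
      (rule minimal_exponentsD[OF _ minimal_exponents_mem])
  then obtain a b where "staircase (card A - 1) a b" and A: "A = (\<lambda>i. (a i, b i)) ` {..card A - 1}"
    using antichain_staircase by blast
  then interpret staircase "card A - 1" a b
    by simp
  have "mu (ideal_mult I I) = card (minimal_exponents pair_sums)"
    unfolding I ideal_mult_monomial sumset_eq_pair_sums[OF A] by (rule mu_monomial_ideal)
  then show ?thesis
    using card_minimal_sums card mu_I by simp
qed

end
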